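(* Let $Q=(U,\leq)$ be a finite poset with $n$ elements and let $k\geq 1$ be a fixed integer. Then $$k\text{-wd}(Q) = n - \mathrm{vc}(G_{Q,k}),$$ where $k\text{-wd}(Q)$ is the $k$-width of $Q$, $G_{Q,k}$ is the $k$-split graph associated to $Q$, and $\mathrm{vc}(G_{Q,k})$ is the minimum size of a vertex cover of $G_{Q,k}$.
   Context: A rooted tree is $k$-ary if every node has at most $k$ children. For a poset $Q=(U,\leq)$, a subset $A\subseteq U$ is called $k$-heapable (equivalently, a $k$-ary chain of $Q$) if there exist a $k$-ary rooted tree $T$ and a bijection between $A$ and the vertices of $T$ such that for all $i,j\in A$, if $j$ is a (proper) descendant of $i$ in $T$ then $i<j$ in $Q$. The $k$-width of $Q$, denoted $k\text{-wd}(Q)$, is the smallest number of classes in a partition of $U$ into $k$-ary chains. The $k$-split graph associated to $Q$ is the bipartite graph $G_{Q,k}=(V_1,V_2,E)$ with $V_1=\{x_1^-,\ldots,x_k^- : x\in U\}$ ($k$ copies of each element), $V_2=\{y^+ : y\in U\}$, and, for all $x,y\in U$ with $x<y$, an edge $x_i^-y^+\in E$ for each $i\in\{1,\ldots,k\}$ (and no other edges). *)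

theory Defs
  imports Main "HOL-Library.Disjoint_Sets"
begin

text \<open>
  A poset is given by a carrier set \<open>U\<close> and a relation \<open>r\<close> with \<open>partial_order_on U r\<close>;
  \<open>(x, y) \<in> r\<close> means \<open>x \<le> y\<close>.
\<close>

definition strictly_below :: "'a rel \<Rightarrow> 'a \<Rightarrow> 'a \<Rightarrow> bool" where
  "strictly_below r x y \<longleftrightarrow> (x, y) \<in> r \<and> x \<noteq> y"

text \<open>
  In a rooted tree with vertex set \<open>V\<close> and root \<open>\<rho>\<close>, a pair \<open>(u, v) \<in> C\<close> means that
  \<open>v\<close> is a child of \<open>u\<close>. The four conditions together exclude cycles: walking backwards
  from a vertex on a cycle along unique parents would never reach the parentless root.
\<close>

definition rooted_tree :: "'v set \<Rightarrow> 'v rel \<Rightarrow> 'v \<Rightarrow> bool" where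
  "rooted_tree V C \<rho> \<longleftrightarrow>
     \<rho> \<in> V \<and> C \<subseteq> V \<times> V \<and>
     (\<forall>u. (u, \<rho>) \<notin> C) \<and>
     (\<forall>v \<in> V - {\<rho>}. \<exists>!u. (u, v) \<in> C) \<and>
     (\<forall>v \<in> V. (\<rho>, v) \<in> C\<^sup>*)"

definition kary_tree :: "nat \<Rightarrow> 'v set \<Rightarrow> 'v rel \<Rightarrow> 'v \<Rightarrow> bool" where
  "kary_tree k V C \<rho> \<longleftrightarrow>
     rooted_tree V C \<rho> \<and> (\<forall>u \<in> V. finite (C `` {u}) \<and> card (C `` {u}) \<le> k)"

text \<open>
  The vertices of the tree are drawn from the type \<open>'a\<close> of the poset. This is no restriction:
  a tree on any other type whose vertices are in bijection with \<open>A\<close> can be transported to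
  \<open>'a\<close> along that bijection. Proper descendants are given by the transitive closure of \<open>C\<close>.
\<close>

definition kary_chain :: "nat \<Rightarrow> 'a set \<Rightarrow> 'a rel \<Rightarrow> 'a set \<Rightarrow> bool" where
  "kary_chain k U r A \<longleftrightarrow>
     A \<subseteq> U \<and>
     (\<exists>(V :: 'a set) C \<rho> f.
        kary_tree k V C \<rho> \<and> bij_betw f A V \<and>
        (\<forall>i \<in> A. \<forall>j \<in> A. (f i, f j) \<in> C\<^sup>+ \<longrightarrow> strictly_below r i j))"

definition k_width :: "nat \<Rightarrow> 'a set \<Rightarrow> 'a rel \<Rightarrow> nat" where
  "k_width k U r =
     (LEAST m. \<exists>P. partition_on U P \<and> (\<forall>A \<in> P. kary_chain k U r A) \<and> finite P \<and> card P = m)"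

text \<open>
  An undirected graph is a pair of a vertex set and a set of edges, each edge being the set
  of its endpoints.
\<close>

type_synonym 'v ugraph = "'v set \<times> 'v set set"

definition vertex_cover :: "'v ugraph \<Rightarrow> 'v set \<Rightarrow> bool" where
  "vertex_cover G S \<longleftrightarrow> S \<subseteq> fst G \<and> (\<forall>e \<in> snd G. e \<inter> S \<noteq> {})"

definition vc :: "'v ugraph \<Rightarrow> nat" where
  "vc G = (LEAST m. \<exists>S. vertex_cover G S \<and> finite S \<and> card S = m)"

text \<open>
  \<open>Minus x i\<close> is \<open>x\<^sub>i\<^sup>-\<close>, the \<open>i\<close>-th left copy of \<open>x\<close>, and \<open>Plus y\<close> is \<open>y\<^sup>+\<close>.
\<close>

datatype 'a split_vertex = Minus 'a nat | Plus 'a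

definition split_left :: "nat \<Rightarrow> 'a set \<Rightarrow> 'a split_vertex set" where
  "split_left k U = {Minus x i | x i. x \<in> U \<and> i \<in> {1..k}}"

definition split_right :: "'a set \<Rightarrow> 'a split_vertex set" where
  "split_right U = {Plus y | y. y \<in> U}"

definition split_edges :: "nat \<Rightarrow> 'a set \<Rightarrow> 'a rel \<Rightarrow> 'a split_vertex set set" where
  "split_edges k U r =
     {{Minus x i, Plus y} | x y i. x \<in> U \<and> y \<in> U \<and> strictly_below r x y \<and> i \<in> {1..k}}"

definition split_graph :: "nat \<Rightarrow> 'a set \<Rightarrow> 'a rel \<Rightarrow> 'a split_vertex ugraph" where
  "split_graph k U r = (split_left k U \<union> split_right U, split_edges k U r)"

end

theory Submission
  imports Defs
begin

text \<open>
  A partition into \<open>m\<close> \<open>k\<close>-ary chains amounts to a forest with \<open>n - m\<close> parent-child edges, all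
  going up in the poset, in which every vertex has at most one parent and at most \<open>k\<close> children.
  Since the \<open>k\<close> copies of an element have the same neighbours, such edge sets correspond to
  matchings of the split graph, and a minimum vertex cover may be taken to contain all or none of
  the copies of each element. The theorem is then Koenig's theorem for bipartite graphs whose left
  vertices have capacity \<open>k\<close>, which follows from the usual alternating path argument.
\<close>

text \<open>The copies of a left element are merged, so only its number of partners is recorded;
  \<open>inj_on snd\<close> gives each right vertex at most one partner. The bound has content for
  finite images only, as \<open>card\<close> is 0 on infinite sets; the counting lemmas assume
  \<open>E\<close> or \<open>U\<close> finite.\<close>

definition k_matching :: "nat \<Rightarrow> 'a rel \<Rightarrow> 'a rel \<Rightarrow> bool" where
  "k_matching k E M \<longleftrightarrow> M \<subseteq> E \<and> inj_on snd M \<and> (\<forall>x. card (M `` {x}) \<le> k)"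

lemma k_matchingD:
  assumes "k_matching k E M"
  shows "M \<subseteq> E" "inj_on snd M" "card (M `` {x}) \<le> k"
    and "(x, z) \<in> M \<Longrightarrow> (y, z) \<in> M \<Longrightarrow> x = y"
  using assms unfolding k_matching_def by (auto dest: inj_onD[of _ _ "(x, z)" "(y, z)"])

lemma k_matching_empty: "k_matching k E {}"
  by (simp add: k_matching_def)

subsection \<open>Koenig's theorem with capacities\<close>

lemma k_matching_insert:
  assumes "k_matching k E M" "(x, y) \<in> E" "y \<notin> Range M" "card (M `` {x}) < k"
  shows "k_matching k E (insert (x, y) M)"
proof -
  have "inj_on snd (insert (x, y) M)"
    using assms(3) k_matchingD(2)[OF assms(1)] by (force simp: inj_on_def)
  moreover have "card (insert (x, y) M `` {z}) \<le> k" for z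
  proof (cases "z = x")
    case True
    have "insert (x, y) M `` {z} = insert y (M `` {x})" using True by auto
    then show ?thesis
      using assms(4) card_insert_le_m1[of k "M `` {x}" y] by (auto simp: le_diff_conv2)
  next
    case False
    then have "insert (x, y) M `` {z} = M `` {z}" by auto
    then show ?thesis using k_matchingD(3)[OF assms(1)] by simp
  qed
  ultimately show ?thesis
    using assms(2) k_matchingD(1)[OF assms(1)] by (auto simp: k_matching_def)
qed

lemma k_matching_remove:
  assumes "finite E" "k_matching k E M"
  shows "k_matching k E (M - N)"
proof -
  have fin: "finite (M `` {x})" for x
    using assms finite_subset k_matchingD(1)[OF assms(2)] finite_Image by metis
  have "card ((M - N) `` {x}) \<le> k" for x
    by (rule order_trans[OF card_mono[OF fin[of x]] k_matchingD(3)[OF assms(2)]]) auto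
  then show ?thesis
    using k_matchingD(1,2)[OF assms(2)] by (auto simp: k_matching_def intro: inj_on_subset)
qed

section \<open>Augmentation along alternating paths\<close>

text \<open>Removing \<open>(x, z)\<close> brings the load of \<open>x\<close> strictly below
  \<open>k\<close>, which makes room for the free vertex \<open>y\<close>.\<close>

lemma k_matching_exchange:
  assumes "finite E" "k_matching k E M" "(x, z) \<in> M" "(x, y) \<in> E" "y \<notin> Range M"
  shows "k_matching k E (insert (x, y) (M - {(x, z)}))"
proof (rule k_matching_insert)
  have fin: "finite (M `` {x})"
    using assms(1) finite_subset k_matchingD(1)[OF assms(2)] finite_Image by metis
  have "card ((M - {(x, z)}) `` {x}) < card (M `` {x})"
    using assms(3) by (intro psubset_card_mono fin) auto
  then show "card ((M - {(x, z)}) `` {x}) < k"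
    using k_matchingD(3)[OF assms(2), of x] by linarith
qed (use assms in \<open>auto intro: k_matching_remove\<close>)

text \<open>Cut the walk at its last visit to \<open>a\<close>: the rest is no longer than the whole
  and never steps into \<open>a\<close> again.\<close>

lemma relpow_no_return:
  assumes "(a, b) \<in> R ^^ n"
  shows "\<exists>m\<le>n. (a, b) \<in> (R - UNIV \<times> {a}) ^^ m"
  using assms
proof (induction n arbitrary: b)
  case (Suc n)
  then obtain c where c: "(a, c) \<in> R ^^ n" "(c, b) \<in> R" by auto
  show ?case
  proof (cases "b = a")
    case True
    then show ?thesis by (intro exI[of _ 0]) auto
  next
    case False
    from Suc.IH[OF c(1)] obtain m where "m \<le> n" "(a, c) \<in> (R - UNIV \<times> {a}) ^^ m" by auto
    with c(2) False show ?thesis by (intro exI[of _ "Suc m"]) auto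
  qed
qed auto

lemma relpow_mono:
  fixes R S :: "'a rel"
  assumes "R \<subseteq> S"
  shows "R ^^ n \<subseteq> S ^^ n"
  using assms by (induction n) (simp_all add: relcomp_mono)

text \<open>A step from \<open>u\<close> to \<open>v\<close> goes from \<open>u\<close> to a left
  neighbour \<open>x\<close> and on to a partner \<open>v\<close> of \<open>x\<close>. The path is
  flipped one step at a time: the first left vertex \<open>x0\<close> exchanges its partner
  \<open>y1\<close> for the free \<open>y0\<close>, so the matching keeps its size and
  \<open>y1\<close> becomes the free start of a shorter path. With no step left, \<open>y\<close> is
  free and \<open>x\<close> has spare capacity, so \<open>(x, y)\<close> can be added. Strong
  induction is used because the remaining path may be cut further.\<close>

lemma k_matching_augment:
  assumes "finite E" "k_matching k E M" "y0 \<notin> Range M"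
    and "(y0, y) \<in> {(u, v). \<exists>x. (x, u) \<in> E \<and> (x, v) \<in> M} ^^ n"
    and "(x, y) \<in> E" "card (M `` {x}) < k"
  shows "\<exists>M'. k_matching k E M' \<and> card M' = Suc (card M)"
  using assms(2-)
proof (induction n arbitrary: M y0 rule: less_induct)
  case (less n)
  let ?D = "\<lambda>M. {(u, v). \<exists>x. (x, u) \<in> E \<and> (x, v) \<in> M}"
  have finM: "finite M"
    using assms(1) less.prems(1) finite_subset k_matchingD(1) by metis
  show ?case
  proof (cases n)
    case 0
    with less.prems have "y = y0" by simp
    have "(x, y) \<notin> M" using less.prems(2) \<open>y = y0\<close> by auto
    then have "card (insert (x, y) M) = Suc (card M)" using finM by simp
    with k_matching_insert[of k E M x y] less.prems \<open>y = y0\<close> show ?thesis by blast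
  next
    case (Suc n')
    obtain y1 where "(y0, y1) \<in> ?D M" and path: "(y1, y) \<in> ?D M ^^ n'"
      using less.prems(3) unfolding Suc by (rule relpow_Suc_E2)
    then obtain x0 where x0: "(x0, y0) \<in> E" "(x0, y1) \<in> M" by auto
    define M' where "M' = insert (x0, y0) (M - {(x0, y1)})"
    have M': "k_matching k E M'"
      unfolding M'_def using assms(1) less.prems x0 by (intro k_matching_exchange)
    have new: "(x0, y0) \<notin> M" using less.prems(2) by auto
    then have card_M': "card M' = card M"
      unfolding M'_def using finM x0(2)
      by (simp add: card_Suc_Diff1 del: card_Diff_insert)
    have y01: "y0 \<noteq> y1" using x0(2) new by auto
    have y1: "y1 \<notin> Range M'"
      using k_matchingD(4)[OF less.prems(1) _ x0(2)] y01 unfolding M'_def by auto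
    \<comment> \<open>a path that never returns to \<open>y1\<close> does not use the removed edge \<open>(x0, y1)\<close>\<close>
    from relpow_no_return[OF path] obtain m where
      m: "m \<le> n'" "(y1, y) \<in> (?D M - UNIV \<times> {y1}) ^^ m" by auto
    have "?D M - UNIV \<times> {y1} \<subseteq> ?D M'" unfolding M'_def by auto
    with m(2) have path': "(y1, y) \<in> ?D M' ^^ m" using relpow_mono by blast
    show ?thesis
    \<comment> \<open>Either way \<open>x\<close> keeps its spare capacity: only the partners of
      \<open>x0\<close> change, and there \<open>y0\<close> replaces \<open>y1\<close>.\<close>
    proof (cases "x = x0")
      case True
      have img: "M' `` {x0} = insert y0 (M `` {x0} - {y1})" unfolding M'_def by auto
      have fin: "finite (M `` {x0})" using finM by (simp add: finite_Image)
      have "card (M' `` {x0}) \<le> Suc (card (M `` {x0} - {y1}))"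
        unfolding img by (simp add: card_insert_le_m1 card_insert_if fin)
      also have "\<dots> = card (M `` {x0})"
        using x0(2) fin by (intro card_Suc_Diff1) auto
      finally have "card (M' `` {x}) < k" using less.prems(5) True by simp
      with less.IH[of m M' y1] m(1) Suc M' y1 path' less.prems(4) card_M' show ?thesis by auto
    next
      case False
      then have "M' `` {x} = M `` {x}" unfolding M'_def by auto
      with less.IH[of m M' y1] m(1) Suc M' y1 path' less.prems(4,5) card_M' show ?thesis by auto
    qed
  qed
qed

section \<open>Duality between matchings and covers\<close>

text \<open>Weak duality: charge every matching edge to an endpoint in the cover. An element of
  \<open>X\<close> is charged at most \<open>k\<close> times, an element of \<open>Y\<close> at most
  once.\<close>

lemma card_k_matching_le_cover:
  assumes "k_matching k E M" "\<And>x y. (x, y) \<in> E \<Longrightarrow> x \<in> X \<or> y \<in> Y"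
    and "finite E" "finite X" "finite Y"
  shows "card M \<le> k * card X + card Y"
proof -
  have finM: "finite M" using assms finite_subset k_matchingD(1) by metis
  let ?A = "SIGMA x:X. M `` {x}" and ?B = "{p \<in> M. snd p \<in> Y}"
  have "M \<subseteq> ?A \<union> ?B"
    using k_matchingD(1)[OF assms(1)] assms(2) by fastforce
  then have "card M \<le> card (?A \<union> ?B)"
    using finM assms(4) by (intro card_mono) (auto simp: finite_Image)
  also have "\<dots> \<le> card ?A + card ?B" by (rule card_Un_le)
  also have "card ?A = (\<Sum>x\<in>X. card (M `` {x}))"
    using assms(4) finM by (intro card_SigmaI) (auto simp: finite_Image)
  also have "\<dots> \<le> k * card X"
    using sum_bounded_above[of X "\<lambda>x. card (M `` {x})" k] k_matchingD(3)[OF assms(1)]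
    by (simp add: mult.commute)
  also have "card ?B \<le> card Y"
    using k_matchingD(2)[OF assms(1)] assms(5)
    by (intro card_inj_on_le[of snd]) (auto intro: inj_on_subset)
  finally show ?thesis by simp
qed

text \<open>Strong duality. For a maximum matching, \<open>X\<close> consists of the left neighbours
  of the right vertices reachable from free ones, and \<open>Y\<close> of the unreachable right
  vertices.\<close>

lemma k_matching_cover_exists:
  assumes "finite E"
  obtains M X Y where "k_matching k E M" "X \<subseteq> Domain E" "Y \<subseteq> Range E"
    and "\<And>x y. (x, y) \<in> E \<Longrightarrow> x \<in> X \<or> y \<in> Y"
    and "k * card X + card Y \<le> card M"
proof -
  have "\<exists>M. k_matching k E M \<and> (\<forall>M'. k_matching k E M' \<longrightarrow> card M' \<le> card M)"
    using k_matching_empty[of k E]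
  proof (rule ex_has_greatest_nat[of _ _ card "Suc (card E)"])
    show "\<forall>M. k_matching k E M \<longrightarrow> card M < Suc (card E)"
      using assms card_mono k_matchingD(1) less_Suc_eq_le by metis
  qed
  then obtain M where M: "k_matching k E M"
    and maxM: "\<And>M'. k_matching k E M' \<Longrightarrow> card M' \<le> card M" by auto
  have finM: "finite M" using assms M finite_subset k_matchingD(1) by metis
  define D where "D = {(u, v). \<exists>x. (x, u) \<in> E \<and> (x, v) \<in> M}"
  define R where "R = D\<^sup>* `` (Range E - Range M)"
  define X where "X = {x. \<exists>y\<in>R. (x, y) \<in> E}"
  define Y where "Y = Range E - R"
  have X: "X \<subseteq> Domain E" and Y: "Y \<subseteq> Range E" by (auto simp: X_def Y_def)
  have finX: "finite X" using X assms by (meson finite_Domain finite_subset)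
  \<comment> \<open>Partners of \<open>X\<close> are reachable, so no matching edge has its left end
    in \<open>X\<close> and its right end in \<open>Y\<close>.\<close>
  have closed: "y \<in> R" if "x \<in> X" "(x, y) \<in> M" for x y
  proof -
    from that obtain u where "u \<in> R" "(x, u) \<in> E" by (auto simp: X_def)
    with that have "(u, y) \<in> D" by (auto simp: D_def)
    with \<open>u \<in> R\<close> show ?thesis unfolding R_def by (blast intro: rtrancl_into_rtrancl)
  qed
  \<comment> \<open>Spare capacity in \<open>X\<close> would end an augmenting path and contradict
    maximality.\<close>
  have full: "card (M `` {x}) = k" if "x \<in> X" for x
  proof (rule ccontr)
    assume "card (M `` {x}) \<noteq> k"
    then have less: "card (M `` {x}) < k" using k_matchingD(3)[OF M, of x] by simp
    from that obtain y0 y where y: "y0 \<notin> Range M" "(y0, y) \<in> D\<^sup>*" "(x, y) \<in> E"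
      by (auto simp: X_def R_def)
    then obtain n where "(y0, y) \<in> D ^^ n" by (auto dest: rtrancl_imp_relpow)
    from k_matching_augment[OF assms M y(1) this[unfolded D_def] y(3) less] maxM
    show False by fastforce
  qed
  let ?A = "SIGMA x:X. M `` {x}" and ?B = "{p \<in> M. snd p \<in> Y}"
  have "k * card X = card ?A"
    using finX finM full by (subst card_SigmaI) (auto simp: finite_Image)
  \<comment> \<open>Free right vertices are reachable by the empty path, so every element of
    \<open>Y\<close> is matched.\<close>
  moreover have "card Y \<le> card ?B"
  proof (rule surj_card_le)
    show "Y \<subseteq> snd ` ?B"
    proof
      fix y assume y: "y \<in> Y"
      then have "y \<in> Range M" by (auto simp: Y_def R_def)
      with y show "y \<in> snd ` ?B" by force
    qed
  qed (use finM in auto)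
  moreover have "card ?A + card ?B = card (?A \<union> ?B)"
    using closed finM finX by (intro card_Un_disjoint[symmetric]) (auto simp: Y_def finite_Image)
  moreover have "card (?A \<union> ?B) \<le> card M"
    using finM by (intro card_mono) auto
  ultimately have "k * card X + card Y \<le> card M" by linarith
  moreover have "x \<in> X \<or> y \<in> Y" if "(x, y) \<in> E" for x y
    using that by (auto simp: X_def Y_def)
  ultimately show thesis using that[OF M X Y] by blast
qed

subsection \<open>Covers of the split graph\<close>

lemma vertex_cover_of_cover:
  assumes "X \<subseteq> U" "Y \<subseteq> U" "finite X" "finite Y"
    and "\<And>x y. x \<in> U \<Longrightarrow> y \<in> U \<Longrightarrow> strictly_below r x y \<Longrightarrow> x \<in> X \<or> y \<in> Y"
  obtains S where "vertex_cover (split_graph k U r) S" "finite S"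
    and "card S = k * card X + card Y"
proof
  let ?A = "(\<lambda>(x, i). Minus x i) ` (X \<times> {1..k})" and ?B = "Plus ` Y"
  have "card (?A \<union> ?B) = card ?A + card ?B"
    using assms by (intro card_Un_disjoint) auto
  also have "card ?A = k * card X"
    by (subst card_image) (auto simp: inj_on_def card_cartesian_product)
  also have "card ?B = card Y" by (intro card_image) (auto simp: inj_on_def)
  finally show "card (?A \<union> ?B) = k * card X + card Y" .
  show "vertex_cover (split_graph k U r) (?A \<union> ?B)"
    using assms by (fastforce simp: vertex_cover_def split_graph_def split_left_def
        split_right_def split_edges_def)
qed (use assms in auto)

text \<open>Keep \<open>x\<close> only if all its copies lie in \<open>S\<close>. If some copy is
  missing, its edges already force \<open>Plus y\<close> into \<open>S\<close> for every
  \<open>y\<close> above \<open>x\<close>.\<close>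

lemma cover_of_vertex_cover:
  assumes "finite U" "vertex_cover (split_graph k U r) S" "finite S"
  obtains X Y where "X \<subseteq> U" "Y \<subseteq> U" "k * card X + card Y \<le> card S"
    and "\<And>x y. x \<in> U \<Longrightarrow> y \<in> U \<Longrightarrow> strictly_below r x y \<Longrightarrow> x \<in> X \<or> y \<in> Y"
proof
  let ?X = "{x \<in> U. \<forall>i \<in> {1..k}. Minus x i \<in> S}" and ?Y = "{y \<in> U. Plus y \<in> S}"
  let ?A = "(\<lambda>(x, i). Minus x i) ` (?X \<times> {1..k})" and ?B = "Plus ` ?Y"
  have "k * card ?X = card ?A"
    by (subst card_image) (auto simp: inj_on_def card_cartesian_product)
  moreover have "card ?Y = card ?B" by (intro card_image[symmetric]) (auto simp: inj_on_def)
  moreover have "card ?A + card ?B = card (?A \<union> ?B)"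
    using assms by (intro card_Un_disjoint[symmetric]) auto
  moreover have "card (?A \<union> ?B) \<le> card S"
    using assms by (intro card_mono) auto
  ultimately show "k * card ?X + card ?Y \<le> card S" by simp
  fix x y assume xy: "x \<in> U" "y \<in> U" "strictly_below r x y"
  show "x \<in> ?X \<or> y \<in> ?Y"
  proof (rule ccontr)
    assume "\<not> ?thesis"
    with xy obtain i where i: "i \<in> {1..k}" "Minus x i \<notin> S" "Plus y \<notin> S" by auto
    with xy have "{Minus x i, Plus y} \<in> snd (split_graph k U r)"
      unfolding split_graph_def split_edges_def by auto
    with assms(2) have "{Minus x i, Plus y} \<inter> S \<noteq> {}" unfolding vertex_cover_def by metis
    with i show False by simp
  qed
qed auto

text \<open>The cover built by strong duality unfolds to a vertex cover of size
  \<open>card M\<close>; any vertex cover folds to a cover whose weight is at least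
  \<open>card M\<close> by weak duality.\<close>

lemma vc_split_graph:
  assumes "finite U" "E = {(x, y) \<in> U \<times> U. strictly_below r x y}"
  obtains M where "k_matching k E M" "vc (split_graph k U r) = card M"
    and "\<And>M'. k_matching k E M' \<Longrightarrow> card M' \<le> card M"
proof -
  have finE: "finite E"
    using assms by (auto intro: finite_subset[of _ "U \<times> U"])
  then obtain M X Y where M: "k_matching k E M" and XY: "X \<subseteq> Domain E" "Y \<subseteq> Range E"
    and cover: "\<And>x y. (x, y) \<in> E \<Longrightarrow> x \<in> X \<or> y \<in> Y" and le: "k * card X + card Y \<le> card M"
    using k_matching_cover_exists[of E k] by blast
  have XU: "X \<subseteq> U" and YU: "Y \<subseteq> U" using XY assms(2) by auto
  then have fin: "finite X" "finite Y" using assms(1) finite_subset by auto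
  have weak: "card M' \<le> k * card X + card Y" if "k_matching k E M'" for M'
    using card_k_matching_le_cover[OF that cover finE fin] .
  show thesis
  proof
    show "k_matching k E M" by fact
    show "card M' \<le> card M" if "k_matching k E M'" for M'
      using weak[OF that] le by simp
    show "vc (split_graph k U r) = card M"
      unfolding vc_def
    proof (rule Least_equality)
      obtain S where "vertex_cover (split_graph k U r) S" "finite S"
        "card S = k * card X + card Y"
        using vertex_cover_of_cover[OF XU YU fin, of r k] cover assms(2) by auto
      then show "\<exists>S. vertex_cover (split_graph k U r) S \<and> finite S \<and> card S = card M"
        using weak[OF M] le by auto
    next
      fix m assume "\<exists>S. vertex_cover (split_graph k U r) S \<and> finite S \<and> card S = m"
      then obtain S where S: "vertex_cover (split_graph k U r) S" "finite S" "card S = m" by auto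
      obtain X' Y' where *: "X' \<subseteq> U" "Y' \<subseteq> U" "k * card X' + card Y' \<le> card S"
        "\<And>x y. x \<in> U \<Longrightarrow> y \<in> U \<Longrightarrow> strictly_below r x y \<Longrightarrow> x \<in> X' \<or> y \<in> Y'"
        using cover_of_vertex_cover[OF assms(1) S(1,2)] by metis
      have "card M \<le> k * card X' + card Y'"
        using * assms finE
        by (intro card_k_matching_le_cover[OF M]) (auto intro: finite_subset)
      with *(3) S(3) show "card M \<le> m" by simp
    qed
  qed
qed

subsection \<open>Partitions into \<open>k\<close>-ary chains as forests\<close>

text \<open>Pull the tree edges back along \<open>f\<close>. A tree has one edge fewer than
  vertices, since each vertex but the root is the child in exactly one edge.\<close>

lemma k_matching_of_kary_chain:
  assumes "finite U" "kary_chain k U r A"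
  obtains M where "k_matching k {(x, y) \<in> U \<times> U. strictly_below r x y} M"
    and "M \<subseteq> A \<times> A" "Suc (card M) = card A"
proof -
  from assms(2) obtain V :: "'a set" and C \<rho> f where AU: "A \<subseteq> U" and tree: "kary_tree k V C \<rho>"
    and f: "bij_betw f A V"
    and below: "\<And>i j. i \<in> A \<Longrightarrow> j \<in> A \<Longrightarrow> (f i, f j) \<in> C\<^sup>+ \<Longrightarrow> strictly_below r i j"
    unfolding kary_chain_def by blast
  have root: "\<rho> \<in> V" "C \<subseteq> V \<times> V" "\<And>u. (u, \<rho>) \<notin> C"
    and parent: "\<And>v. v \<in> V \<Longrightarrow> v \<noteq> \<rho> \<Longrightarrow> \<exists>!u. (u, v) \<in> C"
    and children: "\<And>u. u \<in> V \<Longrightarrow> finite (C `` {u}) \<and> card (C `` {u}) \<le> k"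
    using tree unfolding kary_tree_def rooted_tree_def by auto
  have injf: "inj_on f A" and fA: "f ` A = V" using f by (auto simp: bij_betw_def)
  have finA: "finite A" using AU assms(1) finite_subset by auto
  from root(1) fA obtain a where a: "a \<in> A" "f a = \<rho>" by auto
  define M where "M = {(i, j) \<in> A \<times> A. (f i, f j) \<in> C}"
  have inj: "inj_on snd M"
  proof (rule inj_onI)
    fix p q assume pq: "p \<in> M" "q \<in> M" "snd p = snd q"
    then obtain i j i' where [simp]: "p = (i, j)" "q = (i', j)" by (cases p; cases q) auto
    from pq have *: "i \<in> A" "i' \<in> A" "j \<in> A" "(f i, f j) \<in> C" "(f i', f j) \<in> C"
      by (auto simp: M_def)
    then have "f j \<in> V" "f j \<noteq> \<rho>" using root by auto
    from parent[OF this] * have "f i = f i'" by auto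
    with * injf show "p = q" by (auto dest: inj_onD)
  qed
  \<comment> \<open>Edges are counted by their child ends, which are all elements but the preimage
    \<open>a\<close> of the root.\<close>
  have "snd ` M = A - {a}"
  proof
    show "snd ` M \<subseteq> A - {a}" using a root(3) by (auto simp: M_def)
    show "A - {a} \<subseteq> snd ` M"
    proof
      fix j assume j: "j \<in> A - {a}"
      then have "f j \<in> V" "f j \<noteq> \<rho>" using fA a injf by (auto dest: inj_onD)
      from parent[OF this] obtain u where u: "(u, f j) \<in> C" by auto
      with root(2) fA obtain i where "i \<in> A" "u = f i" by auto
      with u j have "(i, j) \<in> M" by (auto simp: M_def)
      then show "j \<in> snd ` M" by force
    qed
  qed
  then have "card M = card (A - {a})" using card_image[OF inj] by simp
  then have cardM: "Suc (card M) = card A" using a finA by (simp add: card_Suc_Diff1 del: card_Diff_insert)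
  have "card (M `` {x}) \<le> k" for x
  proof (cases "x \<in> A")
    case True
    then have fx: "f x \<in> V" using fA by auto
    have "card (M `` {x}) \<le> card (C `` {f x})"
      using children[OF fx] injf by (intro card_inj_on_le[of f]) (auto simp: M_def inj_on_def)
    with children[OF fx] show ?thesis by simp
  next
    case False
    then have "M `` {x} = {}" by (auto simp: M_def)
    then show ?thesis by simp
  qed
  moreover have "M \<subseteq> {(x, y) \<in> U \<times> U. strictly_below r x y}"
    using below AU by (auto simp: M_def)
  ultimately have "k_matching k {(x, y) \<in> U \<times> U. strictly_below r x y} M"
    using inj by (simp add: k_matching_def)
  moreover have "M \<subseteq> A \<times> A" by (auto simp: M_def)
  ultimately show thesis using that cardM by blast
qed

text \<open>The edges of each class stay inside it, so their union is again a matching, and each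
  class contributes one edge fewer than its size.\<close>

lemma k_matching_of_partition:
  assumes "finite U" "partition_on U P" "\<And>A. A \<in> P \<Longrightarrow> kary_chain k U r A"
  obtains M where "k_matching k {(x, y) \<in> U \<times> U. strictly_below r x y} M"
    and "card M + card P = card U"
proof -
  let ?E = "{(x, y) \<in> U \<times> U. strictly_below r x y}"
  have "\<forall>A\<in>P. \<exists>M. k_matching k ?E M \<and> M \<subseteq> A \<times> A \<and> Suc (card M) = card A"
  proof
    fix A assume "A \<in> P"
    then show "\<exists>M. k_matching k ?E M \<and> M \<subseteq> A \<times> A \<and> Suc (card M) = card A"
      using k_matching_of_kary_chain[OF assms(1) assms(3)] by blast
  qed
  then obtain N where N: "\<And>A. A \<in> P \<Longrightarrow> k_matching k ?E (N A)"
    "\<And>A. A \<in> P \<Longrightarrow> N A \<subseteq> A \<times> A" "\<And>A. A \<in> P \<Longrightarrow> Suc (card (N A)) = card A"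
    by (auto dest!: bchoice)
  have finP: "finite P" using assms(1,2) by (rule finite_elements)
  have U: "U = \<Union>P" and disj: "\<And>A B. A \<in> P \<Longrightarrow> B \<in> P \<Longrightarrow> A \<noteq> B \<Longrightarrow> A \<inter> B = {}"
    using assms(2) by (auto simp: partition_on_def disjoint_def)
  have finA: "finite A" if "A \<in> P" for A using that U assms(1) by (metis Union_upper finite_subset)
  define M where "M = \<Union>(N ` P)"
  have "card M = (\<Sum>A\<in>P. card (N A))"
    unfolding M_def
  proof (rule card_UN_disjoint[OF finP])
    show "\<forall>A\<in>P. finite (N A)" using N(2) finA by (meson finite_SigmaI finite_subset)
    show "\<forall>A\<in>P. \<forall>B\<in>P. A \<noteq> B \<longrightarrow> N A \<inter> N B = {}" using N(2) disj by fast
  qed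
  then have "card M + card P = (\<Sum>A\<in>P. Suc (card (N A)))" by (simp add: sum_Suc)
  also have "\<dots> = (\<Sum>A\<in>P. card A)" using N(3) by simp
  also have "\<dots> = card U"
    unfolding U using disj finA
    by (intro card_Union_disjoint[symmetric]) (auto simp: pairwise_def disjnt_def)
  finally have card: "card M + card P = card U" .
  have inj: "inj_on snd M"
  proof (rule inj_onI)
    fix p q assume pq: "p \<in> M" "q \<in> M" "snd p = snd q"
    then obtain A B where AB: "A \<in> P" "B \<in> P" "p \<in> N A" "q \<in> N B" by (auto simp: M_def)
    with pq N(2) have "snd p \<in> A \<inter> B" by fastforce
    with disj AB have "A = B" by blast
    with AB pq k_matchingD(2)[OF N(1)] show "p = q" by (auto dest: inj_onD)
  qed
  have "card (M `` {x}) \<le> k" for x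
  proof (cases "\<exists>A\<in>P. x \<in> A")
    case True
    then obtain A where A: "A \<in> P" "x \<in> A" by auto
    have "M `` {x} = N A `` {x}" using A N(2) disj by (fastforce simp: M_def)
    with k_matchingD(3)[OF N(1)[OF A(1)]] show ?thesis by simp
  next
    case False
    then have "M `` {x} = {}" using N(2) by (fastforce simp: M_def)
    then show ?thesis by simp
  qed
  moreover have "M \<subseteq> ?E" using k_matchingD(1)[OF N(1)] unfolding M_def by blast
  ultimately have "k_matching k ?E M" using inj by (simp add: k_matching_def)
  then show thesis using that card by blast
qed

section \<open>From matchings back to partitions\<close>

lemma strictly_below_trans:
  assumes "partial_order_on U r" "strictly_below r x y" "strictly_below r y z"
  shows "strictly_below r x z"
  using assms unfolding strictly_below_def partial_order_on_def preorder_on_def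
  by (metis antisymD transD)

lemma trancl_imp_strictly_below:
  assumes "partial_order_on U r" "\<And>x y. (x, y) \<in> C \<Longrightarrow> strictly_below r x y"
    and "(x, y) \<in> C\<^sup>+"
  shows "strictly_below r x y"
  using assms(3)
  by induction (use assms(1,2) in \<open>auto intro: strictly_below_trans\<close>)

text \<open>The matching is read as a forest with root set \<open>R\<close>, the elements without a
  parent; the tree \<open>T \<rho>\<close> consists of all descendants of \<open>\<rho>\<close>,
  itself included. Non-roots correspond to edges, so there are \<open>card U - card M\<close>
  trees.\<close>

lemma partition_of_k_matching:
  assumes "finite U" "partial_order_on U r"
    and M: "k_matching k {(x, y) \<in> U \<times> U. strictly_below r x y} M"
  obtains P where "partition_on U P" "\<And>A. A \<in> P \<Longrightarrow> kary_chain k U r A" "finite P"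
    and "card P + card M = card U"
proof -
  have ME: "M \<subseteq> U \<times> U" "\<And>x y. (x, y) \<in> M \<Longrightarrow> strictly_below r x y"
    using k_matchingD(1)[OF M] by auto
  note uniq = k_matchingD(4)[OF M]
  have finM: "finite M" using ME(1) assms(1) finite_subset by blast
  have below: "strictly_below r x y" if "(x, y) \<in> M\<^sup>+" for x y
    using trancl_imp_strictly_below[OF assms(2) ME(2) that] .
  then have "acyclic M" by (auto simp: acyclic_def strictly_below_def)
  then have wf: "wf M" using finM by (rule finite_acyclic_wf[rotated])
  define R where "R = U - Range M"
  define T where "T = (\<lambda>\<rho>. M\<^sup>* `` {\<rho>})"
  have TU: "T \<rho> \<subseteq> U" if "\<rho> \<in> R" for \<rho>
  proof -
    have "y \<in> U" if "(\<rho>, y) \<in> M\<^sup>*" for y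
      using that by induction (use ME(1) \<open>\<rho> \<in> R\<close> in \<open>auto simp: R_def\<close>)
    then show ?thesis by (auto simp: T_def)
  qed
  \<comment> \<open>Parents are unique, so both paths retrace the same ancestors of \<open>y\<close>
    up to a parentless one.\<close>
  have T_inter: "\<rho> = \<rho>'" if "\<rho> \<in> R" "\<rho>' \<in> R" "(\<rho>, y) \<in> M\<^sup>*" "(\<rho>', y) \<in> M\<^sup>*" for \<rho> \<rho>' y
    using that(3,4)
  proof induction
    case base
    then show ?case using that(1) by (auto simp: R_def elim: rtranclE)
  next
    case (step y z)
    from step.prems show ?case
    proof (cases rule: rtranclE)
      case base
      then show ?thesis using step.hyps that(2) by (auto simp: R_def)
    next
      case (step u)
      with uniq \<open>(y, z) \<in> M\<close> have "u = y" by blast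
      with step \<open>(\<rho>', y) \<in> M\<^sup>* \<Longrightarrow> \<rho> = \<rho>'\<close> show ?thesis by blast
    qed
  qed
  \<comment> \<open>Climbing from child to parent stops at a root, as \<open>M\<close> is
    well-founded.\<close>
  have T_cover: "\<exists>\<rho>\<in>R. y \<in> T \<rho>" if "y \<in> U" for y
    using wf that
  proof (induction y rule: wf_induct_rule)
    case (less y)
    show ?case
    proof (cases "y \<in> Range M")
      case True
      then obtain x where x: "(x, y) \<in> M" by auto
      then have "x \<in> U" using ME(1) by auto
      with less x obtain \<rho> where "\<rho> \<in> R" "x \<in> T \<rho>" by auto
      with x show ?thesis by (auto simp: T_def intro: rtrancl_into_rtrancl)
    next
      case False
      with less show ?thesis by (auto simp: R_def T_def)
    qed
  qed
  have chain: "kary_chain k U r (T \<rho>)" if \<rho>: "\<rho> \<in> R" for \<rho>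
  proof -
    \<comment> \<open>Restricting the parent ends suffices: \<open>T \<rho>\<close> is closed under
      taking children.\<close>
    define C where "C = M \<inter> T \<rho> \<times> UNIV"
    have reach: "(\<rho>, v) \<in> C\<^sup>*" if "v \<in> T \<rho>" for v
    proof -
      have "(\<rho>, v) \<in> M\<^sup>*" using that by (simp add: T_def)
      then show ?thesis
      proof induction
        case (step y z)
        then have "(y, z) \<in> C" by (auto simp: C_def T_def)
        with step.IH show ?case by (rule rtrancl_into_rtrancl)
      qed auto
    qed
    have "\<exists>!u. (u, v) \<in> C" if v: "v \<in> T \<rho> - {\<rho>}" for v
    proof -
      from reach v obtain u where "(u, v) \<in> C" by (auto elim: rtranclE)
      then show ?thesis using uniq by (auto simp: C_def)
    qed
    moreover have "C \<subseteq> T \<rho> \<times> T \<rho>"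
      by (auto simp: C_def T_def intro: rtrancl_into_rtrancl)
    moreover have "\<forall>u. (u, \<rho>) \<notin> C" using \<rho> by (auto simp: C_def R_def)
    moreover have "\<rho> \<in> T \<rho>" by (simp add: T_def)
    ultimately have "rooted_tree (T \<rho>) C \<rho>"
      using reach unfolding rooted_tree_def by blast
    moreover have "finite (C `` {u}) \<and> card (C `` {u}) \<le> k" if "u \<in> T \<rho>" for u
    proof -
      have "C `` {u} = M `` {u}" using that by (auto simp: C_def)
      then show ?thesis using finM k_matchingD(3)[OF M] by (simp add: finite_Image)
    qed
    ultimately have "kary_tree k (T \<rho>) C \<rho>" by (simp add: kary_tree_def)
    moreover have "strictly_below r i j" if "(i, j) \<in> C\<^sup>+" for i j
      using below trancl_mono[OF that, of M] by (auto simp: C_def)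
    \<comment> \<open>The tree lives on \<open>T \<rho>\<close> itself, with the identity as
      bijection.\<close>
    ultimately show ?thesis
      unfolding kary_chain_def using TU[OF \<rho>] bij_betw_id[of "T \<rho>"]
      by (metis id_apply)
  qed
  have self: "\<rho> \<in> T \<rho>" for \<rho> by (simp add: T_def)
  have "partition_on U (T ` R)"
  proof (rule partition_onI)
    show "\<Union> (T ` R) = U" using TU T_cover by blast
    show "\<And>p q. p \<in> T ` R \<Longrightarrow> q \<in> T ` R \<Longrightarrow> p \<noteq> q \<Longrightarrow> disjnt p q"
      using T_inter by (auto simp: disjnt_def T_def)
    show "{} \<notin> T ` R" using self by blast
  qed
  moreover have "card (T ` R) + card M = card U"
  proof -
    have "inj_on T R"
      using T_inter self by (auto simp: inj_on_def T_def)
    then have "card (T ` R) = card R" by (rule card_image)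
    moreover have "card M = card (Range M)"
      using card_image[OF k_matchingD(2)[OF M]] by (simp add: Range_snd)
    moreover have "Range M \<subseteq> U" using ME(1) by auto
    ultimately show ?thesis
      using assms(1) by (simp add: R_def card_Diff_subset finite_subset card_mono)
  qed
  moreover have "finite (T ` R)" using assms(1) by (simp add: R_def)
  ultimately show thesis using that chain by blast
qed

text \<open>The equation is stated in \<open>int\<close> to avoid truncated subtraction.\<close>

theorem theorem1:
  fixes U :: "'a set" and r :: "'a rel" and n k :: nat
  assumes "finite U"
    and "partial_order_on U r"
    and "card U = n"
    and "k \<ge> 1"
  shows "int (k_width k U r) = int n - int (vc (split_graph k U r))"
proof -
  let ?E = "{(x, y) \<in> U \<times> U. strictly_below r x y}"
  obtain M where M: "k_matching k ?E M" and vc: "vc (split_graph k U r) = card M"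
    and max: "\<And>M'. k_matching k ?E M' \<Longrightarrow> card M' \<le> card M"
    using vc_split_graph[OF assms(1) refl, of k r] by blast
  obtain P where P: "partition_on U P" "\<And>A. A \<in> P \<Longrightarrow> kary_chain k U r A" "finite P"
    "card P + card M = card U"
    using partition_of_k_matching[OF assms(1,2) M] by blast
  \<comment> \<open>A partition with fewer classes than \<open>P\<close> would yield a matching
    larger than the maximum \<open>M\<close>.\<close>
  have "k_width k U r = card P"
    unfolding k_width_def
  proof (rule Least_equality)
    show "\<exists>Q. partition_on U Q \<and> (\<forall>A\<in>Q. kary_chain k U r A) \<and> finite Q \<and> card Q = card P"
      using P by blast
  next
    fix m assume "\<exists>Q. partition_on U Q \<and> (\<forall>A\<in>Q. kary_chain k U r A) \<and> finite Q \<and> card Q = m"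
    then obtain Q where Q: "partition_on U Q" "\<And>A. A \<in> Q \<Longrightarrow> kary_chain k U r A" "card Q = m"
      by blast
    obtain M' where "k_matching k ?E M'" "card M' + card Q = card U"
      using k_matching_of_partition[OF assms(1) Q(1,2)] by blast
    with max[of M'] P(4) Q(3) show "card P \<le> m" by simp
  qed
  with P(4) vc assms(3) show ?thesis by simp
qed

end
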